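(* For every integer $n\ge 0$ and real $x\ge0$, $$\frac{H_n(x,2)+(H_n(x,1))^2}{\binom{x+n+1}{n}(x+1)}=2!\sum_{k=0}^{n}\binom{n}{k}(-1)^k\frac{1}{(x+k+1)^3},$$ and $$\frac{2H_n(x,3)+3H_n(x,1)H_n(x,2)+(H_n(x,1))^3}{\binom{x+n+1}{n}(x+1)}=3!\sum_{k=0}^{n}\binom{n}{k}(-1)^k\frac{1}{(x+k+1)^4}.$$ In particular (for $x=0$), $$2!\sum_{k=0}^{n}\binom{n}{k}\frac{(-1)^k}{(k+1)^3}=\frac{H_{n+1}^{(2)}+(H_{n+1})^2}{n+1},\qquad 3!\sum_{k=0}^{n}\binom{n}{k}\frac{(-1)^k}{(k+1)^4}=\frac{2H_{n+1}^{(3)}+3H_{n+1}H_{n+1}^{(2)}+(H_{n+1})^3}{n+1}.$$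
   Context: For a positive integer $\alpha$, an integer $n\ge0$ and real $x\ge 0$, $H_n(x,\alpha)=\sum_{k=0}^{n}\frac{1}{(k+x+1)^{\alpha}}$. For positive integers $\alpha$, $H_m^{(\alpha)}=\sum_{j=1}^{m}\frac{1}{j^\alpha}$ ($H_0^{(\alpha)}=0$) and $H_m=H_m^{(1)}$. For real $y$ and integer $k\ge0$, $\binom{y}{k}=\frac{y(y-1)\cdots(y-k+1)}{k!}$. *)

theory Defs
  imports Complex_Main
begin

definition shifted_harm :: "nat \<Rightarrow> real \<Rightarrow> nat \<Rightarrow> real" where
  "shifted_harm n x \<alpha> = (\<Sum>k=0..n. 1 / (real k + x + 1) ^ \<alpha>)"

definition gen_harm :: "nat \<Rightarrow> nat \<Rightarrow> real" where
  "gen_harm \<alpha> m = (\<Sum>j=1..m. 1 / real j ^ \<alpha>)"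

end

theory Submission
  imports Defs
begin

text \<open>
  Write \<open>S\<^sub>p(n)\<close> for the alternating binomial sum of \<open>1 / (x + k + 1)^p\<close> and \<open>D(n)\<close> for
  the denominator on the left-hand side. Absorption gives
  \<open>(x + n + 2) S\<^sub>p\<^sub>+\<^sub>1(n + 1) = (n + 1) S\<^sub>p\<^sub>+\<^sub>1(n) + S\<^sub>p(n + 1)\<close>, so \<open>T\<^sub>p = D S\<^sub>p\<close>
  satisfies \<open>T\<^sub>p\<^sub>+\<^sub>1(n + 1) = T\<^sub>p\<^sub>+\<^sub>1(n) + T\<^sub>p(n + 1) / (x + n + 2)\<close> with \<open>T\<^sub>1 = 1\<close>. Hence
  \<open>T\<^sub>p\<^sub>+\<^sub>1(n)\<close> is the complete homogeneous symmetric polynomial of degree \<open>p\<close> in the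
  numbers \<open>1 / (x + k + 1)\<close>, \<open>k \<le> n\<close>; expressing these polynomials in degrees 2 and 3
  through power sums gives the theorem.
\<close>

definition alt_binom_sum :: "nat \<Rightarrow> nat \<Rightarrow> real \<Rightarrow> real" where
  "alt_binom_sum p n x = (\<Sum>k=0..n. real (n choose k) * (- 1) ^ k * (1 / (x + real k + 1) ^ p))"

definition binom_denom :: "nat \<Rightarrow> real \<Rightarrow> real" where
  "binom_denom n x = ((x + real n + 1) gchoose n) * (x + 1)"

text \<open>This is the expansion of (1 - 1)^(n + 1). It removes the inhomogeneous term of the
  recurrence at \<open>p = 0\<close>, so that T_1 stays constant in \<open>n\<close>.\<close>

lemma alt_binom_sum_0_Suc: "alt_binom_sum 0 (Suc n) x = 0"
  using choose_alternating_sum[of "Suc n", where 'a = real]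
  by (simp add: alt_binom_sum_def atMost_atLeast0 mult.commute)

lemma alt_binom_sum_Suc:
  assumes "x \<ge> 0"
  shows "(x + real n + 2) * alt_binom_sum (Suc p) (Suc n) x
    = (real n + 1) * alt_binom_sum (Suc p) n x + alt_binom_sum p (Suc n) x"
proof -
  let ?f = "\<lambda>p k. (- 1) ^ k * (1 / (x + real k + 1) ^ p)"
  have "(real n + 1) * alt_binom_sum (Suc p) n x
      = (\<Sum>k=0..n. (real n + 1) * real (n choose k) * ?f (Suc p) k)"
    by (simp add: alt_binom_sum_def sum_distrib_left mult.assoc)
  \<comment> \<open>Absorption in the lower row: (n + 1 - k) C(n + 1, k) = (n + 1) C(n, k).\<close>
  also have "\<dots> = (\<Sum>k=0..n. (real n + 1 - real k) * real (Suc n choose k) * ?f (Suc p) k)"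
  proof (rule sum.cong[OF refl])
    fix k assume "k \<in> {0..n}"
    then have "real ((Suc n - k) * (Suc n choose k)) = real (Suc n * (n choose k))"
      by (simp only: binomial_absorb_comp) simp
    then have "(real n + 1 - real k) * real (Suc n choose k) = (real n + 1) * real (n choose k)"
      using \<open>k \<in> {0..n}\<close> by (simp only: of_nat_mult) (simp add: of_nat_diff algebra_simps)
    then show "(real n + 1) * real (n choose k) * ?f (Suc p) k
        = (real n + 1 - real k) * real (Suc n choose k) * ?f (Suc p) k"
      by simp
  qed
  \<comment> \<open>The added term k = n + 1 vanishes because of the factor n + 1 - k.\<close>
  also have "\<dots> = (\<Sum>k=0..Suc n. (real n + 1 - real k) * real (Suc n choose k) * ?f (Suc p) k)"
    by simp
  \<comment> \<open>Split n + 1 - k = (x + n + 2) - (x + k + 1); the second part cancels one power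
    of the denominator.\<close>
  also have "\<dots> = (\<Sum>k=0..Suc n. (x + real n + 2) * (real (Suc n choose k) * ?f (Suc p) k)
      - real (Suc n choose k) * ?f p k)"
  proof (rule sum.cong[OF refl])
    fix k
    have "x + real k + 1 \<noteq> 0"
      using assms by linarith
    then have *: "?f p k = (x + real k + 1) * ?f (Suc p) k"
      by simp
    have **: "(real n + 1 - real k) * c * f
        = (x + real n + 2) * (c * f) - c * ((x + real k + 1) * f)" for c f
      by (simp add: algebra_simps)
    show "(real n + 1 - real k) * real (Suc n choose k) * ?f (Suc p) k
        = (x + real n + 2) * (real (Suc n choose k) * ?f (Suc p) k) - real (Suc n choose k) * ?f p k"
      unfolding * by (rule **)
  qed
  also have "\<dots> = (x + real n + 2) * alt_binom_sum (Suc p) (Suc n) x - alt_binom_sum p (Suc n) x"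
    by (simp only: alt_binom_sum_def sum_subtractf sum_distrib_left mult.assoc)
  finally show ?thesis
    by simp
qed

text \<open>Passing from \<open>n\<close> to \<open>Suc n\<close> raises both the upper and the
  lower entry of the binomial coefficient by one, which is the shape of the absorption identity for
  real upper entry.\<close>

lemma binom_denom_Suc:
  "(real n + 1) * binom_denom (Suc n) x = (x + real n + 2) * binom_denom n x"
proof -
  have "real (Suc n) * ((x + real n + 2) gchoose Suc n)
      = (x + real n + 2) * ((x + real n + 1) gchoose n)"
    using gbinomial_absorption[of n "x + real n + 2"] by (simp add: add_ac)
  then show ?thesis
    by (simp add: binom_denom_def add.assoc add.commute)
qed

lemma binom_denom_pos:
  assumes "x \<ge> 0"
  shows "binom_denom n x > 0"
proof (induction n)
  case 0
  then show ?case using assms by (simp add: binom_denom_def)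
next
  case (Suc n)
  then have "(real n + 1) * binom_denom (Suc n) x > 0"
    using assms by (simp only: binom_denom_Suc) simp
  then show ?case
    by (simp add: zero_less_mult_iff)
qed

text \<open>Multiply \<open>alt_binom_sum_Suc\<close> by D(n + 1). By \<open>binom_denom_Suc\<close>
  the coefficient (n + 1) D(n + 1) becomes (x + n + 2) D(n), and the common factor x + n + 2 can be
  divided out.\<close>

lemma binom_denom_alt_binom_sum_Suc:
  assumes "x \<ge> 0"
  shows "binom_denom (Suc n) x * alt_binom_sum (Suc p) (Suc n) x
    = binom_denom n x * alt_binom_sum (Suc p) n x
      + binom_denom (Suc n) x * alt_binom_sum p (Suc n) x / (x + real n + 2)"
proof -
  have nz: "x + real n + 2 \<noteq> 0"
    using assms by linarith
  have "(x + real n + 2) * (binom_denom (Suc n) x * alt_binom_sum (Suc p) (Suc n) x)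
      = (x + real n + 2) * (binom_denom n x * alt_binom_sum (Suc p) n x)
        + binom_denom (Suc n) x * alt_binom_sum p (Suc n) x"
    using alt_binom_sum_Suc[OF assms, of n p] binom_denom_Suc[of n x] by algebra
  then show ?thesis
    using nz by (simp add: field_simps)
qed

lemma shifted_harm_Suc:
  "shifted_harm (Suc n) x p = shifted_harm n x p + (1 / (x + real n + 2)) ^ p"
  by (simp add: shifted_harm_def power_one_over add_ac)

lemma binom_denom_alt_binom_sum_0:
  assumes "x \<ge> 0"
  shows "binom_denom 0 x * alt_binom_sum (Suc p) 0 x = (1 / (x + 1)) ^ p"
  using assms by (simp add: binom_denom_def alt_binom_sum_def power_one_over)

lemma binom_denom_alt_binom_sum_1:
  assumes "x \<ge> 0"
  shows "binom_denom n x * alt_binom_sum 1 n x = 1"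
proof (induction n)
  case 0
  show ?case using binom_denom_alt_binom_sum_0[OF assms, of 0] by simp
next
  case (Suc n)
  then show ?case
    using binom_denom_alt_binom_sum_Suc[OF assms, of n 0] by (simp add: alt_binom_sum_0_Suc)
qed

lemma binom_denom_alt_binom_sum_2:
  assumes "x \<ge> 0"
  shows "binom_denom n x * alt_binom_sum 2 n x = shifted_harm n x 1"
proof (induction n)
  case 0
  show ?case
    using binom_denom_alt_binom_sum_0[OF assms, of 1] by (simp add: shifted_harm_def numeral_2_eq_2)
next
  case (Suc n)
  then show ?case
    using binom_denom_alt_binom_sum_Suc[OF assms, of n 1]
      binom_denom_alt_binom_sum_1[OF assms, of "Suc n"]
    by (simp add: shifted_harm_Suc numeral_2_eq_2)
qed

text \<open>Newton's identity 2 h_2 = p_2 + p_1^2 for the power sums p_i =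
  \<open>shifted_harm n x i\<close>, proved by adjoining one variable at a time.\<close>

lemma binom_denom_alt_binom_sum_3:
  assumes "x \<ge> 0"
  shows "2 * (binom_denom n x * alt_binom_sum 3 n x)
    = shifted_harm n x 2 + (shifted_harm n x 1)\<^sup>2"
proof (induction n)
  case 0
  show ?case
    using binom_denom_alt_binom_sum_0[OF assms, of 2]
    by (simp add: shifted_harm_def power_one_over)
next
  case (Suc n)
  define a where "a = 1 / (x + real n + 2)"
  have "binom_denom (Suc n) x * alt_binom_sum 3 (Suc n) x
      = binom_denom n x * alt_binom_sum 3 n x + shifted_harm (Suc n) x 1 * a"
    using binom_denom_alt_binom_sum_Suc[OF assms, of n 2]
      binom_denom_alt_binom_sum_2[OF assms, of "Suc n"]
    by (simp add: a_def)
  moreover have "shifted_harm (Suc n) x 1 = shifted_harm n x 1 + a"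
    "shifted_harm (Suc n) x 2 = shifted_harm n x 2 + a ^ 2"
    using shifted_harm_Suc[of n x, folded a_def] by simp_all
  \<comment> \<open>Both sides grow by 2 a (p_1 + a).\<close>
  ultimately show ?case
    using Suc by algebra
qed

text \<open>The degree 3 analogue, 6 h_3 = 2 p_3 + 3 p_1 p_2 + p_1^3.\<close>

lemma binom_denom_alt_binom_sum_4:
  assumes "x \<ge> 0"
  shows "6 * (binom_denom n x * alt_binom_sum 4 n x)
    = 2 * shifted_harm n x 3 + 3 * shifted_harm n x 1 * shifted_harm n x 2
      + (shifted_harm n x 1) ^ 3"
proof (induction n)
  case 0
  show ?case
    using binom_denom_alt_binom_sum_0[OF assms, of 3]
    by (simp add: shifted_harm_def power_one_over power2_eq_square power3_eq_cube)
next
  case (Suc n)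
  define a where "a = 1 / (x + real n + 2)"
  have step: "binom_denom (Suc n) x * alt_binom_sum 4 (Suc n) x
      = binom_denom n x * alt_binom_sum 4 n x
        + binom_denom (Suc n) x * alt_binom_sum 3 (Suc n) x * a"
    using binom_denom_alt_binom_sum_Suc[OF assms, of n 3] by (simp add: a_def)
  have harm: "shifted_harm (Suc n) x 1 = shifted_harm n x 1 + a"
    "shifted_harm (Suc n) x 2 = shifted_harm n x 2 + a ^ 2"
    "shifted_harm (Suc n) x 3 = shifted_harm n x 3 + a ^ 3"
    using shifted_harm_Suc[of n x, folded a_def] by simp_all
  \<comment> \<open>The left side grows by 6 a h_2, taken at \<open>Suc n\<close>. The degree 2
    identity turns this into 3 a ((p_2 + a^2) + (p_1 + a)^2), the growth of the right side.\<close>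
  show ?case
    using Suc step harm binom_denom_alt_binom_sum_3[OF assms, of "Suc n"] by algebra
qed

lemma gen_harm_eq_shifted_harm: "gen_harm p (n + 1) = shifted_harm n 0 p"
  unfolding gen_harm_def shifted_harm_def
  using sum.shift_bounds_cl_Suc_ivl[of "\<lambda>j. 1 / real j ^ p" 0 n] by (simp add: add.commute)

text \<open>At x = 0 the coefficient is the ordinary C(n + 1, n).\<close>

lemma binom_denom_at_0: "binom_denom n 0 = real n + 1"
  using binomial_gbinomial[of "Suc n" n, where 'a = real]
  by (simp add: binom_denom_def add.commute)

theorem theorem2p3:
  fixes n :: nat
  shows
    "(\<forall>x::real. x \<ge> 0 \<longrightarrow>
        (shifted_harm n x 2 + (shifted_harm n x 1)\<^sup>2)
            / (((x + real n + 1) gchoose n) * (x + 1))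
          = fact 2 * (\<Sum>k=0..n. real (n choose k) * (- 1) ^ k * (1 / (x + real k + 1) ^ 3)) \<and>
        (2 * shifted_harm n x 3 + 3 * shifted_harm n x 1 * shifted_harm n x 2
              + (shifted_harm n x 1) ^ 3)
            / (((x + real n + 1) gchoose n) * (x + 1))
          = fact 3 * (\<Sum>k=0..n. real (n choose k) * (- 1) ^ k * (1 / (x + real k + 1) ^ 4))) \<and>
     fact 2 * (\<Sum>k=0..n. real (n choose k) * ((- 1) ^ k / (real k + 1) ^ 3))
       = (gen_harm 2 (n + 1) + (gen_harm 1 (n + 1))\<^sup>2) / (real n + 1) \<and>
     fact 3 * (\<Sum>k=0..n. real (n choose k) * ((- 1) ^ k / (real k + 1) ^ 4))
       = (2 * gen_harm 3 (n + 1) + 3 * gen_harm 1 (n + 1) * gen_harm 2 (n + 1)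
            + (gen_harm 1 (n + 1)) ^ 3) / (real n + 1)"
proof -
  have general: "(shifted_harm n x 2 + (shifted_harm n x 1)\<^sup>2) / binom_denom n x
        = fact 2 * alt_binom_sum 3 n x"
    "(2 * shifted_harm n x 3 + 3 * shifted_harm n x 1 * shifted_harm n x 2
        + (shifted_harm n x 1) ^ 3) / binom_denom n x = fact 3 * alt_binom_sum 4 n x"
    if "x \<ge> 0" for x
    using binom_denom_pos[OF that, of n]
      binom_denom_alt_binom_sum_3[OF that, of n] binom_denom_alt_binom_sum_4[OF that, of n]
    by (simp_all add: fact_numeral field_simps)
  have at_0: "(\<Sum>k=0..n. real (n choose k) * ((- 1) ^ k / (real k + 1) ^ p)) = alt_binom_sum p n 0" for p
    by (simp add: alt_binom_sum_def)
  show ?thesis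
    \<comment> \<open>After this rewriting the last two conjuncts are the instance x = 0 of
      \<open>general\<close>.\<close>
    unfolding at_0 gen_harm_eq_shifted_harm
    using general general[of 0] by (simp add: alt_binom_sum_def binom_denom_at_0 flip: binom_denom_def)
qed

end
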